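(* Let $f,g_1,\ldots,g_m\in\mathbb{R}[\mathbf{x}]$ be real polynomials in $\mathbf{x}=(x_1,\ldots,x_n)$, let $\mathbf{K}=\{\mathbf{x}\in\mathbb{R}^n : g_j(\mathbf{x})\ge 0,\ j=1,\ldots,m\}$ (not assumed compact), and let $f^*=\inf\{f(\mathbf{x}) : \mathbf{x}\in\mathbf{K}\}$. Assume that $f$ and $-g_j$, $j=1,\ldots,m$, are convex, that Slater's condition holds (there exists $\mathbf{x}_0\in\mathbf{K}$ such that $g_j(\mathbf{x}_0)>0$ for every $j=1,\ldots,m$), and that $f^*>-\infty$. For $\lambda\in\mathbb{R}^m$ with $\lambda\ge0$ let $$G_1(\lambda)=\inf_{\mathbf{x}\in\mathbb{R}^n}\Big\{f(\mathbf{x})-\sum_{j=1}^m\lambda_j g_j(\mathbf{x})\Big\},\qquad \rho_1=\sup\{G_1(\lambda) : \lambda\in\mathbb{R}^m,\ \lambda\ge 0\}.$$ Then $\rho_1=f^*$, and $\rho_1=G_1(\lambda^* )$ for some nonnegative $\lambda^*\in\mathbb{R}^m$.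
   Context: $\lambda\ge0$ means that all entries of $\lambda$ are nonnegative. $\rho_1$ is the first ($d=1$) relaxation, i.e. the standard Lagrangian relaxation of $\min\{f(\mathbf{x}):\mathbf{x}\in\mathbf{K}\}$. Values of $G_1$ are taken in the extended reals. *)

theory Defs
  imports "HOL-Analysis.Analysis"
begin

definition feasible_set :: "('m::finite \<Rightarrow> real ^ 'n \<Rightarrow> real) \<Rightarrow> (real ^ 'n) set" where
  "feasible_set g = {x. \<forall>j. g j x \<ge> 0}"

(* All infima and suprema are taken in the extended reals, since the value of
   the dual function at a given multiplier may be -\<infinity>. *)

definition optimal_value ::
    "(real ^ 'n \<Rightarrow> real) \<Rightarrow> ('m::finite \<Rightarrow> real ^ 'n \<Rightarrow> real) \<Rightarrow> ereal" where
  "optimal_value f g = (INF x \<in> feasible_set g. ereal (f x))"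

definition dual_function ::
    "(real ^ 'n \<Rightarrow> real) \<Rightarrow> ('m::finite \<Rightarrow> real ^ 'n \<Rightarrow> real) \<Rightarrow> real ^ 'm \<Rightarrow> ereal" where
  "dual_function f g u = (INF x. ereal (f x - (\<Sum>j\<in>UNIV. u $ j * g j x)))"

definition dual_value ::
    "(real ^ 'n \<Rightarrow> real) \<Rightarrow> ('m::finite \<Rightarrow> real ^ 'n \<Rightarrow> real) \<Rightarrow> ereal" where
  "dual_value f g = (SUP u \<in> {u. \<forall>j. u $ j \<ge> 0}. dual_function f g u)"

end

theory Submission
  imports Defs
begin

text \<open>
  Weak duality is immediate: at a feasible point a nonnegative combination of the \<open>g j\<close> can only
  lower the objective.  The converse is a separation argument in the value space
  \<open>\<real> \<times> \<real>\<^sup>m\<close>.  Let \<open>p\<close> be the optimal value, which is a real number because the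
  feasible set is nonempty.  Consider the pairs \<open>(t, y)\<close> such that some \<open>x\<close> satisfies
  \<open>f x - p < t\<close> and \<open>- g j x \<le> y $ j\<close> for all \<open>j\<close>.  They form a convex set, and it misses the
  origin precisely because no feasible point has a value below \<open>p\<close>.  A hyperplane through the
  origin bounding this set has a normal vector \<open>(a, b)\<close> with nonnegative entries, since the set
  is closed under increasing coordinates; Slater's condition excludes the vertical hyperplanes
  \<open>a = 0\<close>; and \<open>b / a\<close> is then a multiplier whose Lagrangian is bounded below by \<open>p\<close>
  (lemma \<open>convex_lagrange_multiplier\<close>).  By weak duality this multiplier attains the dual
  supremum, and that supremum equals \<open>p\<close>.
\<close>

text \<open>
  The objective inequality is strict, so that a lower bound \<open>p\<close> which is attained still leaves the
  origin outside the set; the constraint inequalities are weak, to match the feasible set at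
  \<open>y = 0\<close>.
\<close>

definition value_set ::
    "('a \<Rightarrow> real) \<Rightarrow> ('m::finite \<Rightarrow> 'a \<Rightarrow> real) \<Rightarrow> real \<Rightarrow> (real \<times> (real ^ 'm)) set" where
  "value_set f g p = {(t, y). \<exists>x. f x - p < t \<and> (\<forall>j. - g j x \<le> y $ j)}"

lemma value_set_iff: "(t, y) \<in> value_set f g p \<longleftrightarrow> (\<exists>x. f x - p < t \<and> (\<forall>j. - g j x \<le> y $ j))"
  by (simp add: value_set_def)

lemma convex_value_set:
  fixes f :: "'a::real_vector \<Rightarrow> real" and g :: "'m::finite \<Rightarrow> 'a \<Rightarrow> real"
  assumes f: "convex_on UNIV f" and g: "\<And>j. convex_on UNIV (\<lambda>x. - g j x)"
  shows "convex (value_set f g p)"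
proof (rule convexI)
  fix z1 z2 :: "real \<times> (real ^ 'm)" and v w :: real
  assume z: "z1 \<in> value_set f g p" "z2 \<in> value_set f g p"
    and vw: "0 \<le> v" "0 \<le> w" "v + w = 1"
  obtain t1 y1 t2 y2 where zz: "z1 = (t1, y1)" "z2 = (t2, y2)" by fastforce
  obtain x1 where x1: "f x1 - p < t1" "\<And>j. - g j x1 \<le> y1 $ j"
    using z zz by (auto simp: value_set_iff)
  obtain x2 where x2: "f x2 - p < t2" "\<And>j. - g j x2 \<le> y2 $ j"
    using z zz by (auto simp: value_set_iff)
  let ?x = "v *\<^sub>R x1 + w *\<^sub>R x2"
  have "f ?x - p \<le> (v * f x1 + w * f x2) - (v + w) * p"
    using f vw by (simp add: convex_on_def)
  also have "\<dots> = v * (f x1 - p) + w * (f x2 - p)"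
    by (simp add: algebra_simps)
  also have "\<dots> < v * t1 + w * t2"
  proof (cases "v = 0")
    case True
    then show ?thesis using x2 vw by simp
  next
    case False
    then have "v * (f x1 - p) < v * t1" using x1 vw by simp
    moreover have "w * (f x2 - p) \<le> w * t2" using x2 vw by (simp add: mult_left_mono)
    ultimately show ?thesis by linarith
  qed
  finally have "f ?x - p < v * t1 + w * t2" .
  moreover have "- g j ?x \<le> v * y1 $ j + w * y2 $ j" for j
  proof -
    have "- g j ?x \<le> v * (- g j x1) + w * (- g j x2)"
      using g[of j] vw by (simp add: convex_on_def)
    also have "\<dots> \<le> v * y1 $ j + w * y2 $ j"
      using x1(2)[of j] x2(2)[of j] vw by (intro add_mono mult_left_mono) auto
    finally show ?thesis .
  qed
  ultimately show "v *\<^sub>R z1 + w *\<^sub>R z2 \<in> value_set f g p"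
    unfolding zz by (auto simp: value_set_iff)
qed

text \<open>
  The set lies in the half-space \<open>a * t + b \<bullet> y \<ge> 0\<close> although its coordinates can be
  increased without bound, so no entry of the normal vector can be negative.
\<close>

lemma value_set_normal_nonneg:
  fixes f :: "'a \<Rightarrow> real" and g :: "'m::finite \<Rightarrow> 'a \<Rightarrow> real"
  assumes sep: "\<And>t y. (t, y) \<in> value_set f g p \<Longrightarrow> 0 \<le> a * t + b \<bullet> y"
  shows "0 \<le> a" and "0 \<le> b $ j"
proof -
  fix x :: 'a
  define t where "t = f x - p + 1"
  define y :: "real ^ 'm" where "y = (\<chi> j. - g j x)"
  define c where "c = a * t + b \<bullet> y"
  have up: "(t + s, y + r *\<^sub>R axis j 1) \<in> value_set f g p" if "0 \<le> s" "0 \<le> r" for s r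
    unfolding value_set_iff t_def y_def using that by (intro exI[of _ x]) (auto simp: axis_def)
  have bound: "0 \<le> c + a * s + r * b $ j" if "0 \<le> s" "0 \<le> r" for s r
    using sep[OF up[OF that]] by (simp add: c_def inner_axis algebra_simps)
  have c0: "0 \<le> c" using bound[of 0 0] by simp
  show "0 \<le> a"
  proof (rule ccontr)
    assume "\<not> 0 \<le> a"
    then show False using bound[of "(c + 1) / - a" 0] c0 by (simp add: field_simps)
  qed
  show "0 \<le> b $ j"
  proof (rule ccontr)
    assume "\<not> 0 \<le> b $ j"
    then show False using bound[of 0 "(c + 1) / - (b $ j)"] c0 by (simp add: field_simps)
  qed
qed

text \<open>
  Separating the origin from the value set gives a normal vector \<open>(a, b)\<close>.  If \<open>a\<close> were \<open>0\<close>,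
  the bound at a Slater point would read \<open>b \<bullet> y \<ge> 0\<close> with all entries of \<open>y\<close> negative,
  which forces \<open>b = 0\<close> as well.
\<close>

lemma convex_lagrange_multiplier:
  fixes f :: "'a::real_vector \<Rightarrow> real" and g :: "'m::finite \<Rightarrow> 'a \<Rightarrow> real"
  assumes f: "convex_on UNIV f" and g: "\<And>j. convex_on UNIV (\<lambda>x. - g j x)"
    and x0: "\<And>j. g j x0 > 0"
    and p: "\<And>x. \<forall>j. g j x \<ge> 0 \<Longrightarrow> p \<le> f x"
  obtains u :: "real ^ 'm"
  where "\<And>j. u $ j \<ge> 0" and "\<And>x. p \<le> f x - (\<Sum>j\<in>UNIV. u $ j * g j x)"
proof -
  have "0 \<notin> value_set f g p"
  proof
    assume "0 \<in> value_set f g p"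
    then obtain x where "f x < p" and "\<forall>j. g j x \<ge> 0"
      by (auto simp: zero_prod_def value_set_iff)
    then show False using p[of x] by simp
  qed
  moreover have "convex (value_set f g p)"
    using f g by (rule convex_value_set)
  ultimately obtain n where n: "n \<noteq> 0" "\<forall>z\<in>value_set f g p. 0 \<le> n \<bullet> z"
    using separating_hyperplane_set_0 by blast
  obtain a b where ab: "n = (a, b)" by fastforce
  have sep: "0 \<le> a * t + b \<bullet> y" if "(t, y) \<in> value_set f g p" for t y
    using n(2) that unfolding ab by fastforce
  have a0: "0 \<le> a" and b0: "0 \<le> b $ j" for j
    using value_set_normal_nonneg[of f g p a b, OF sep] by simp_all
  \<comment> \<open>The inequality \<open>f x - p < t\<close> is strict, so the pair \<open>(f x - p, - g x)\<close> itself is only a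
    limit point of the value set; the bound there comes from letting the excess \<open>e\<close> tend to 0.\<close>
  have key: "0 \<le> a * (f x - p) - (\<Sum>j\<in>UNIV. b $ j * g j x)" for x
  proof (rule field_le_epsilon)
    fix e :: real assume e: "0 < e"
    have "(f x - p + e / (a + 1), \<chi> j. - g j x) \<in> value_set f g p"
      using e a0 unfolding value_set_iff by (intro exI[of _ x]) simp
    from sep[OF this] have "0 \<le> a * (f x - p) + a * (e / (a + 1)) - (\<Sum>j\<in>UNIV. b $ j * g j x)"
      by (simp add: inner_vec_def sum_negf algebra_simps)
    moreover have "a * (e / (a + 1)) \<le> e"
      using e a0 by (simp add: field_simps)
    ultimately show "0 \<le> a * (f x - p) - (\<Sum>j\<in>UNIV. b $ j * g j x) + e" by linarith
  qed
  have "a \<noteq> 0"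
  proof
    assume a: "a = 0"
    have pos: "0 \<le> b $ j * g j x0" for j
      using b0 x0[of j] by simp
    have "(\<Sum>j\<in>UNIV. b $ j * g j x0) = 0"
      using key[of x0] a sum_nonneg[of UNIV "\<lambda>j. b $ j * g j x0"] pos by simp
    then have "b $ j * g j x0 = 0" for j
      using pos by (simp add: sum_nonneg_eq_0_iff)
    moreover have "g j x0 \<noteq> 0" for j
      using x0[of j] by simp
    ultimately have "b $ j = 0" for j
      by simp
    then have "b = 0" by (simp add: vec_eq_iff)
    then show False using n(1) ab a by (simp add: zero_prod_def)
  qed
  then have a: "0 < a" using a0 by simp
  show ?thesis
  proof
    show "(b /\<^sub>R a) $ j \<ge> 0" for j
      using b0 a by simp
    show "p \<le> f x - (\<Sum>j\<in>UNIV. (b /\<^sub>R a) $ j * g j x)" for x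
    proof -
      have "(\<Sum>j\<in>UNIV. (b /\<^sub>R a) $ j * g j x) = (\<Sum>j\<in>UNIV. b $ j * g j x) / a"
        by (simp add: sum_distrib_left divide_inverse mult_ac)
      moreover have "p \<le> f x - (\<Sum>j\<in>UNIV. b $ j * g j x) / a"
        using key[of x] a by (simp add: field_simps)
      ultimately show ?thesis by linarith
    qed
  qed
qed

lemma dual_function_le_optimal_value:
  fixes f :: "real ^ 'n \<Rightarrow> real" and g :: "'m::finite \<Rightarrow> real ^ 'n \<Rightarrow> real"
  assumes u: "\<And>j. u $ j \<ge> 0"
  shows "dual_function f g u \<le> optimal_value f g"
  unfolding optimal_value_def
proof (rule INF_greatest)
  fix x assume "x \<in> feasible_set g"
  then have "0 \<le> (\<Sum>j\<in>UNIV. u $ j * g j x)"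
    using u by (simp add: feasible_set_def sum_nonneg)
  moreover have "dual_function f g u \<le> ereal (f x - (\<Sum>j\<in>UNIV. u $ j * g j x))"
    unfolding dual_function_def by (rule INF_lower) simp
  ultimately show "dual_function f g u \<le> ereal (f x)"
    by (auto elim: order_trans)
qed

theorem theorem2p3:
  fixes f :: "real ^ 'n \<Rightarrow> real"
    and g :: "'m::finite \<Rightarrow> real ^ 'n \<Rightarrow> real"
  assumes "real_polynomial_function f"
    and "\<And>j. real_polynomial_function (g j)"
    and "convex_on UNIV f"
    and "\<And>j. convex_on UNIV (\<lambda>x. - g j x)"
    and slater: "\<exists>x0 \<in> feasible_set g. \<forall>j. g j x0 > 0"
    and "optimal_value f g > - \<infinity>"
  shows "dual_value f g = optimal_value f g \<and>
    (\<exists>u :: real ^ 'm. (\<forall>j. u $ j \<ge> 0) \<and> dual_value f g = dual_function f g u)"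
proof -
  obtain x0 where x0: "x0 \<in> feasible_set g" "\<And>j. g j x0 > 0"
    using slater by blast
  have val_le: "optimal_value f g \<le> ereal (f x)" if "x \<in> feasible_set g" for x
    unfolding optimal_value_def using that by (rule INF_lower)
  obtain p where p: "optimal_value f g = ereal p"
    using assms(6) val_le[OF x0(1)] by (cases "optimal_value f g") auto
  have p_le: "p \<le> f x" if "\<forall>j. g j x \<ge> 0" for x
    using val_le[of x] that p by (simp add: feasible_set_def)
  obtain u :: "real ^ 'm" where u: "\<And>j. u $ j \<ge> 0"
    and lower: "\<And>x. p \<le> f x - (\<Sum>j\<in>UNIV. u $ j * g j x)"
    using convex_lagrange_multiplier[of f g x0 p, OF assms(3,4) x0(2) p_le] by blast
  have "optimal_value f g \<le> dual_function f g u"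
    unfolding p dual_function_def by (rule INF_greatest) (simp add: lower)
  moreover have "dual_function f g u \<le> dual_value f g"
    unfolding dual_value_def using u by (intro SUP_upper) simp
  moreover have "dual_value f g \<le> optimal_value f g"
    unfolding dual_value_def by (intro SUP_least dual_function_le_optimal_value) simp
  ultimately show ?thesis using u by (intro conjI exI[of _ u]) auto
qed

end
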